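(* For any time window size $\lambda$, a minimum-size TWC target set for a path $L^n$ on $n$ nodes (with any threshold function $t$ satisfying $1\le t(v)\le\deg(v)$) can be computed in time $O(n)$.
   Context: For a graph $G=(V,E)$ with thresholds $t:V\to\{1,2,\dots\}$, $1\le t(v)\le\deg(v)$, a time window size $\lambda\in\{1,2,\dots\}$ and $S\subseteq V$, define $\mathrm{Inf}[S,0]=S$, $\mathrm{Act}[S,0]=\emptyset$, and for $r\ge1$: $\mathrm{Act}[S,r]=\mathrm{Inf}[S,r-1]$ if $r\le\lambda$, $\mathrm{Act}[S,r]=\mathrm{Inf}[S,r-1]\setminus\mathrm{Inf}[S,r-1-\lambda]$ if $r>\lambda$, and $\mathrm{Inf}[S,r]=\mathrm{Inf}[S,r-1]\cup\{v: |N(v)\cap \mathrm{Act}[S,r]|\ge t(v)\}$, where $N(v)$ is the neighborhood of $v$. $S$ is a TWC target set if $\mathrm{Inf}[S,r]=V$ for some $r\ge0$. *)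

theory Defs
  imports Complex_Main "HOL-Library.Landau_Symbols"
begin

section \<open>Influence diffusion under a time window constraint\<close>

type_synonym 'a graph = "'a set \<times> 'a set set"

definition verts :: "'a graph \<Rightarrow> 'a set" where
  "verts G = fst G"

definition edges :: "'a graph \<Rightarrow> 'a set set" where
  "edges G = snd G"

definition neighborhood :: "'a graph \<Rightarrow> 'a \<Rightarrow> 'a set" where
  "neighborhood G v = {u. {u, v} \<in> edges G}"

definition degree :: "'a graph \<Rightarrow> 'a \<Rightarrow> nat" where
  "degree G v = card (neighborhood G v)"

definition threshold_function :: "'a graph \<Rightarrow> ('a \<Rightarrow> nat) \<Rightarrow> bool" where
  "threshold_function G t \<longleftrightarrow> (\<forall>v\<in>verts G. 1 \<le> t v \<and> t v \<le> degree G v)"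

function infl :: "'a graph \<Rightarrow> ('a \<Rightarrow> nat) \<Rightarrow> nat \<Rightarrow> 'a set \<Rightarrow> nat \<Rightarrow> 'a set"
  and act :: "'a graph \<Rightarrow> ('a \<Rightarrow> nat) \<Rightarrow> nat \<Rightarrow> 'a set \<Rightarrow> nat \<Rightarrow> 'a set"
where
  "infl G t lam S 0 = S"
| "infl G t lam S (Suc r) =
     infl G t lam S r \<union>
     {v \<in> verts G. t v \<le> card (neighborhood G v \<inter> act G t lam S (Suc r))}"
| "act G t lam S 0 = {}"
| "act G t lam S (Suc r) =
     (if Suc r \<le> lam then infl G t lam S r
      else infl G t lam S r - infl G t lam S (r - lam))"
  by pat_completeness auto
termination
  by (relation "measure (\<lambda>x. case x of Inl (G, t, lam, S, r) \<Rightarrow> 2 * r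
                                | Inr (G, t, lam, S, r) \<Rightarrow> 2 * r - 1)") auto

definition twc_target_set :: "'a graph \<Rightarrow> ('a \<Rightarrow> nat) \<Rightarrow> nat \<Rightarrow> 'a set \<Rightarrow> bool" where
  "twc_target_set G t lam S \<longleftrightarrow> S \<subseteq> verts G \<and> (\<exists>r. infl G t lam S r = verts G)"

definition min_twc_target_set :: "'a graph \<Rightarrow> ('a \<Rightarrow> nat) \<Rightarrow> nat \<Rightarrow> 'a set \<Rightarrow> bool" where
  "min_twc_target_set G t lam S \<longleftrightarrow>
     twc_target_set G t lam S \<and> (\<forall>S'. twc_target_set G t lam S' \<longrightarrow> card S \<le> card S')"

definition path_graph :: "nat \<Rightarrow> nat graph" where
  "path_graph n = ({0..<n}, {{i, Suc i} | i. Suc i < n})"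


section \<open>Random access machine with unit-cost instructions\<close>

text \<open>
  Integer registers and an integer memory, both addressed by naturals.  Arithmetic is
  restricted to addition and subtraction, so that charging one time unit per instruction is
  the usual uniform cost criterion.  Memory addresses are taken from registers, a negative
  content being read as address 0; jump targets are absolute positions in the program.
\<close>

datatype instr =
    Const nat int         \<comment> \<open>\<open>R[i] := k\<close>\<close>
  | Move nat nat          \<comment> \<open>\<open>R[i] := R[j]\<close>\<close>
  | Add nat nat nat       \<comment> \<open>\<open>R[i] := R[j] + R[k]\<close>\<close>
  | Sub nat nat nat       \<comment> \<open>\<open>R[i] := R[j] - R[k]\<close>\<close>
  | Load nat nat          \<comment> \<open>\<open>R[i] := M[R[j]]\<close>\<close>
  | Store nat nat         \<comment> \<open>\<open>M[R[i]] := R[j]\<close>\<close>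
  | Jump nat
  | JumpLess nat nat nat  \<comment> \<open>\<open>if R[i] < R[j] then goto l\<close>\<close>

type_synonym program = "instr list"

record config =
  pc :: nat
  reg :: "nat \<Rightarrow> int"
  mem :: "nat \<Rightarrow> int"

fun exec :: "instr \<Rightarrow> config \<Rightarrow> config" where
  "exec (Const i k) c = c\<lparr>pc := Suc (pc c), reg := (reg c)(i := k)\<rparr>"
| "exec (Move i j) c = c\<lparr>pc := Suc (pc c), reg := (reg c)(i := reg c j)\<rparr>"
| "exec (Add i j k) c = c\<lparr>pc := Suc (pc c), reg := (reg c)(i := reg c j + reg c k)\<rparr>"
| "exec (Sub i j k) c = c\<lparr>pc := Suc (pc c), reg := (reg c)(i := reg c j - reg c k)\<rparr>"
| "exec (Load i j) c = c\<lparr>pc := Suc (pc c), reg := (reg c)(i := mem c (nat (reg c j)))\<rparr>"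
| "exec (Store i j) c = c\<lparr>pc := Suc (pc c), mem := (mem c)(nat (reg c i) := reg c j)\<rparr>"
| "exec (Jump l) c = c\<lparr>pc := l\<rparr>"
| "exec (JumpLess i j l) c = c\<lparr>pc := (if reg c i < reg c j then l else Suc (pc c))\<rparr>"

definition halted :: "program \<Rightarrow> config \<Rightarrow> bool" where
  "halted P c \<longleftrightarrow> length P \<le> pc c"

definition step :: "program \<Rightarrow> config \<Rightarrow> config" where
  "step P c = (if halted P c then c else exec (P ! pc c) c)"

definition run :: "program \<Rightarrow> nat \<Rightarrow> config \<Rightarrow> config" where
  "run P T c = (step P ^^ T) c"

text \<open>
  An instance is passed to a program with the number of nodes in register 0, the window size
  in register 1 and the thresholds along the path in memory cells \<open>0, \<dots>, n - 1\<close>.  A set of nodes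
  is returned as its characteristic vector in the same cells.
\<close>

definition path_input :: "nat \<Rightarrow> nat \<Rightarrow> (nat \<Rightarrow> nat) \<Rightarrow> config" where
  "path_input n lam t =
     \<lparr>pc = 0,
      reg = (\<lambda>i. if i = 0 then int n else if i = 1 then int lam else 0),
      mem = (\<lambda>i. if i < n then int (t i) else 0)\<rparr>"

definition is_output_set :: "nat \<Rightarrow> config \<Rightarrow> nat set \<Rightarrow> bool" where
  "is_output_set n c S \<longleftrightarrow>
     S \<subseteq> {0..<n} \<and> (\<forall>i<n. mem c i = (if i \<in> S then 1 else 0))"

end

(*
  In a path, an infection spreads freely over nodes of threshold one, while a non-seed of
  threshold two is infected only if its two sides reach it less than lam rounds apart.  Hence S is
  a target set iff it is nonempty, contains a node on either side (inclusively) of every threshold-two node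
  and, between consecutive seeds l < r there is at most one threshold-two node v, which must satisfy
  |l + r - 2 v| < lam.

  The least size, cost y, of such a chain of seeds ending in y is determined, up to one bit, by the last
  threshold-two node p before y: it is cost p or cost p + 1.  The smaller value is attained iff some
  node l in an interval around 2 p - y, lying between p and the threshold-two node before p, has
  cost (cost p - 1).  Storing for each position the last candidate l at or before it answers this
  query in constant time, so that one scan computes an optimal predecessor of every node; a second
  loop follows the predecessors back from the last threshold-two node.
*)
theory Submission
  imports Defs
begin

section \<open>Diffusion on a path\<close>

lemma verts_path [simp]: "verts (path_graph n) = {0..<n}"
  by (simp add: verts_def path_graph_def)

lemma neighborhood_path:
  "neighborhood (path_graph n) v = {u. u = Suc v \<and> Suc v < n \<or> v = Suc u \<and> v < n}"
  by (auto simp: neighborhood_def edges_def path_graph_def doubleton_eq_iff)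

lemma infl_mono: "r \<le> r' \<Longrightarrow> infl G t lam S r \<subseteq> infl G t lam S r'"
  by (rule lift_Suc_mono_le[of "infl G t lam S"]) auto

lemma infl_seed: "v \<in> S \<Longrightarrow> v \<in> infl G t lam S r"
  using infl_mono[of 0 r G t lam S] by auto

lemma infl_verts: "S \<subseteq> verts G \<Longrightarrow> infl G t lam S r \<subseteq> verts G"
  by (induction r) auto

lemma act_iff:
  "u \<in> act G t lam S (Suc r) \<longleftrightarrow>
     u \<in> infl G t lam S r \<and> (lam \<le> r \<longrightarrow> u \<notin> infl G t lam S (r - lam))"
  by auto

text \<open>The condition on consecutive seeds \<open>l\<close> and \<open>r\<close>. For
  \<open>v\<close> between them, \<open>l + r - 2 v\<close> is the distance \<open>r - v\<close>
  minus the distance \<open>v - l\<close>, hence the lead of one infection over the other on arrival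
  at \<open>v\<close>.\<close>

definition hop :: "(nat \<Rightarrow> bool) \<Rightarrow> nat \<Rightarrow> nat \<Rightarrow> nat \<Rightarrow> bool" where
  "hop T lam l r \<longleftrightarrow> l < r \<and> (\<forall>v. l < v \<and> v < r \<and> T v \<longrightarrow>
     (\<forall>w. l < w \<and> w < r \<and> T w \<longrightarrow> w = v) \<and> \<bar>int l + int r - 2 * int v\<bar> < int lam)"

text \<open>Characterizes target sets without mentioning rounds. The predicate \<open>T\<close> is a
  parameter because it is instantiated both for nodes counted from 0 and for positions counted from
  1.\<close>

definition spans :: "(nat \<Rightarrow> bool) \<Rightarrow> nat \<Rightarrow> nat set \<Rightarrow> bool" where
  "spans T lam S \<longleftrightarrow> S \<noteq> {} \<and> (\<forall>v. T v \<longrightarrow> (\<exists>s\<in>S. s \<le> v) \<and> (\<exists>s\<in>S. v \<le> s)) \<and>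
     (\<forall>l\<in>S. \<forall>r\<in>S. l < r \<and> (\<forall>x. l < x \<and> x < r \<longrightarrow> x \<notin> S) \<longrightarrow> hop T lam l r)"

lemma Max_lt_obtain:
  assumes "s \<in> S" "s < (v :: nat)"
  obtains l where "l \<in> S" "l < v" "\<And>x. l < x \<Longrightarrow> x < v \<Longrightarrow> x \<notin> S"
proof -
  have fin: "finite {x \<in> S. x < v}" by (rule finite_subset[of _ "{..v}"]) auto
  moreover have ne: "{x \<in> S. x < v} \<noteq> {}" using assms by auto
  ultimately have "Max {x \<in> S. x < v} \<in> {x \<in> S. x < v}" by (rule Max_in)
  moreover have "x \<notin> S" if "Max {x \<in> S. x < v} < x" "x < v" for x
    using Max_ge[OF fin, of x] that not_le by blast
  ultimately show thesis using that by blast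
qed

lemma Min_gt_obtain:
  assumes "s \<in> S" "(v :: nat) < s"
  obtains r where "r \<in> S" "v < r" "\<And>x. v < x \<Longrightarrow> x < r \<Longrightarrow> x \<notin> S"
proof -
  define r where "r = (LEAST x. x \<in> S \<and> v < x)"
  have "r \<in> S \<and> v < r" unfolding r_def by (rule LeastI[of _ s]) (use assms in simp)
  moreover have "x \<notin> S" if "v < x" "x < r" for x
    using not_less_Least[of x "\<lambda>x. x \<in> S \<and> v < x"] that unfolding r_def by blast
  ultimately show thesis using that by blast
qed

declare infl.simps(2) [simp del] act.simps(2) [simp del]

section \<open>Rounds of infection on a path\<close>

locale path_instance =
  fixes n lam :: nat and t :: "nat \<Rightarrow> nat"
  assumes lam: "1 \<le> lam" and thr: "threshold_function (path_graph n) t"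
begin

definition two :: "nat \<Rightarrow> bool" where
  "two v \<longleftrightarrow> v < n \<and> 1 < t v"

lemma two_inner: assumes "two v" shows "0 < v" "Suc v < n" "t v = 2"
proof -
  have v: "v < n" "1 < t v" using assms by (auto simp: two_def)
  have deg: "t v \<le> card (neighborhood (path_graph n) v)"
    using thr v by (auto simp: threshold_function_def degree_def)
  have sub: "neighborhood (path_graph n) v \<subseteq> {v - 1, Suc v}"
    by (auto simp: neighborhood_path)
  \<comment> \<open>This also holds for \<open>v = 0\<close>, where \<open>v - 1\<close> is 0; since
    0 is not adjacent to itself, equality of the two sets then rules out
    \<open>v = 0\<close>.\<close>
  have "card {v - 1, Suc v} = 2" by simp
  then have full: "neighborhood (path_graph n) v = {v - 1, Suc v}"
    using card_seteq[OF _ sub] deg v by simp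
  have "v - 1 \<in> neighborhood (path_graph n) v" "Suc v \<in> neighborhood (path_graph n) v"
    using full by auto
  then show "0 < v" "Suc v < n" by (auto simp: neighborhood_path)
  show "t v = 2" using deg v full by simp
qed

lemma not_two: "v < n \<Longrightarrow> \<not> two v \<Longrightarrow> t v = 1"
  using thr by (force simp: two_def threshold_function_def)

lemma infl_Suc_path:
  assumes "v < n"
  shows "v \<in> infl (path_graph n) t lam S (Suc r) \<longleftrightarrow>
     v \<in> infl (path_graph n) t lam S r \<or>
     (if two v then v - 1 \<in> act (path_graph n) t lam S (Suc r) \<and> Suc v \<in> act (path_graph n) t lam S (Suc r)
      else 0 < v \<and> v - 1 \<in> act (path_graph n) t lam S (Suc r) \<or>
           Suc v < n \<and> Suc v \<in> act (path_graph n) t lam S (Suc r))"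
proof -
  let ?A = "act (path_graph n) t lam S (Suc r)"
  let ?N = "neighborhood (path_graph n) v"
  have "t v \<le> card (?N \<inter> ?A) \<longleftrightarrow> (if two v then v - 1 \<in> ?A \<and> Suc v \<in> ?A
      else 0 < v \<and> v - 1 \<in> ?A \<or> Suc v < n \<and> Suc v \<in> ?A)"
  proof (cases "two v")
    case True
    have N: "?N = {v - 1, Suc v}" using two_inner[OF True] by (auto simp: neighborhood_path)
    have "2 \<le> card ({v - 1, Suc v} \<inter> ?A) \<longleftrightarrow> {v - 1, Suc v} \<inter> ?A = {v - 1, Suc v}"
      using card_seteq[of "{v - 1, Suc v}" "{v - 1, Suc v} \<inter> ?A"] by fastforce
    then show ?thesis using True N two_inner[OF True] by auto
  next
    case False
    have fin: "finite (?N \<inter> ?A)"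
      by (rule finite_subset[of _ "{v - 1, Suc v}"]) (auto simp: neighborhood_path)
    have "1 \<le> card (?N \<inter> ?A) \<longleftrightarrow> ?N \<inter> ?A \<noteq> {}"
      using fin card_gt_0_iff[of "?N \<inter> ?A"] by linarith
    also have "\<dots> \<longleftrightarrow> 0 < v \<and> v - 1 \<in> ?A \<or> Suc v < n \<and> Suc v \<in> ?A"
    proof -
      have "?N = {u. 0 < v \<and> u = v - 1 \<or> Suc v < n \<and> u = Suc v}"
        using assms by (auto simp: neighborhood_path)
      moreover have "{u. 0 < v \<and> u = v - 1 \<or> Suc v < n \<and> u = Suc v} \<inter> A \<noteq> {} \<longleftrightarrow>
          0 < v \<and> v - 1 \<in> A \<or> Suc v < n \<and> Suc v \<in> A" for A
        by blast
      ultimately show ?thesis by simp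
    qed
    finally show ?thesis using False not_two[OF assms False] by simp
  qed
  then show ?thesis using assms by (simp add: infl.simps(2))
qed

text \<open>As \<open>lam\<close> is at least 1, \<open>u\<close> is active in the round right after
  its first infection, and one active neighbour suffices for a node of threshold one.\<close>

lemma infl_spread:
  assumes "u \<in> infl (path_graph n) t lam S k" "u = Suc v \<or> v = Suc u" "u < n" "v < n" "\<not> two v"
  shows "v \<in> infl (path_graph n) t lam S (Suc k)"
proof -
  define k0 where "k0 = (LEAST k. u \<in> infl (path_graph n) t lam S k)"
  have 1: "u \<in> infl (path_graph n) t lam S k0" "k0 \<le> k"
    unfolding k0_def using assms(1) by (auto intro: LeastI Least_le)
  have "u \<notin> infl (path_graph n) t lam S j" if "j < k0" for j
    using that not_less_Least k0_def by blast
  then have "u \<in> act (path_graph n) t lam S (Suc k0)"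
    using 1 lam unfolding act_iff by auto
  then have "v \<in> infl (path_graph n) t lam S (Suc k0)"
    using assms unfolding infl_Suc_path[OF assms(4)] by auto
  then show ?thesis using infl_mono[of "Suc k0" "Suc k" "path_graph n" t lam S] 1 by auto
qed

lemma infl_spread_right:
  assumes "u \<in> infl (path_graph n) t lam S k" "u + d < n" "\<And>v. u < v \<Longrightarrow> v \<le> u + d \<Longrightarrow> \<not> two v"
  shows "u + d \<in> infl (path_graph n) t lam S (k + d)"
  using assms
proof (induction d)
  case (Suc d)
  then have "u + d \<in> infl (path_graph n) t lam S (k + d)" by auto
  from infl_spread[OF this, of "u + Suc d"] Suc.prems show ?case by simp
qed simp

lemma infl_spread_left:
  assumes "u \<in> infl (path_graph n) t lam S k" "d \<le> u" "u < n" "\<And>v. u - d \<le> v \<Longrightarrow> v < u \<Longrightarrow> \<not> two v"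
  shows "u - d \<in> infl (path_graph n) t lam S (k + d)"
  using assms
proof (induction d)
  case (Suc d)
  then have "u - d \<in> infl (path_graph n) t lam S (k + d)" by auto
  from infl_spread[OF this, of "u - Suc d"] Suc.prems show ?case by (simp add: Suc_diff_Suc)
qed simp

text \<open>A candidate \<open>g\<close> for the infection process on \<open>X\<close> need only be checked locally when no
  non-seed of \<open>X\<close> has a neighbour outside \<open>X\<close>.\<close>

lemma infl_local:
  assumes X: "X \<subseteq> {..<n}"
    and seeds: "\<And>v. v \<in> X \<Longrightarrow> v \<in> S \<Longrightarrow> (\<And>r. g r v)"
    and nonseeds: "\<And>v. v \<in> X \<Longrightarrow> v \<notin> S \<Longrightarrow> \<not> g 0 v"
    and closed: "\<And>v. v \<in> X \<Longrightarrow> v \<notin> S \<Longrightarrow> 0 < v \<and> v - 1 \<in> X \<and> Suc v \<in> X"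
    and rec: "\<And>v r. v \<in> X \<Longrightarrow> v \<notin> S \<Longrightarrow>
       g (Suc r) v \<longleftrightarrow> g r v \<or>
         (if two v then (g r (v - 1) \<and> (lam \<le> r \<longrightarrow> \<not> g (r - lam) (v - 1)))
                     \<and> (g r (Suc v) \<and> (lam \<le> r \<longrightarrow> \<not> g (r - lam) (Suc v)))
          else (g r (v - 1) \<and> (lam \<le> r \<longrightarrow> \<not> g (r - lam) (v - 1)))
                     \<or> (g r (Suc v) \<and> (lam \<le> r \<longrightarrow> \<not> g (r - lam) (Suc v))))"
    and "v \<in> X"
  shows "v \<in> infl (path_graph n) t lam S r \<longleftrightarrow> g r v"
  using \<open>v \<in> X\<close>
proof (induction r arbitrary: v rule: less_induct)
  case (less r)
  show ?case
  proof (cases "v \<in> S")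
    case True
    then show ?thesis using seeds[OF less.prems True] infl_seed[OF True] by simp
  next
    case False
    show ?thesis
    proof (cases r)
      case 0
      then show ?thesis using False nonseeds less.prems by simp
    next
      case (Suc k)
      have act: "u \<in> act (path_graph n) t lam S (Suc k) \<longleftrightarrow>
          g k u \<and> (lam \<le> k \<longrightarrow> \<not> g (k - lam) u)" if "u \<in> X" for u
        using less.IH[OF _ that, of k] less.IH[OF _ that, of "k - lam"] Suc
        by (simp add: act_iff)
      have v: "v < n" "Suc v < n" "0 < v" "v - 1 \<in> X" "Suc v \<in> X"
        using closed[OF less.prems False] X less.prems by auto
      show ?thesis
        unfolding Suc infl_Suc_path[OF v(1)] rec[OF less.prems False] act[OF v(4)] act[OF v(5)]
        using less.IH[OF _ less.prems, of k] Suc v by simp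
    qed
  qed
qed

text \<open>The infection advances one node per round from each seed, reaching the two neighbours of
  \<open>w\<close> independently; \<open>w\<close> is infected iff both are active in a common
  round. The explicit process \<open>g\<close> is verified by \<open>infl_local\<close>.\<close>

lemma infl_between_seeds:
  assumes "l \<in> S" "r \<in> S" "l < w" "w < r" "r < n" and gap: "\<And>x. l < x \<Longrightarrow> x < r \<Longrightarrow> x \<notin> S"
    and w: "\<And>x. l < x \<Longrightarrow> x < r \<Longrightarrow> two x \<longleftrightarrow> x = w"
  shows "w \<in> infl (path_graph n) t lam S k \<longleftrightarrow>
     \<bar>int l + int r - 2 * int w\<bar> < int lam \<and> w - l \<le> k \<and> r - w \<le> k"
proof -
  define g where "g k x \<longleftrightarrow> (if x = w then \<bar>int l + int r - 2 * int w\<bar> < int lam \<and> w - l \<le> k \<and> r - w \<le> k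
      else if x < w then x - l \<le> k else r - x \<le> k)" for k x
  have "w \<in> infl (path_graph n) t lam S k \<longleftrightarrow> g k w"
  proof (rule infl_local[where X = "{l..r}"])
    fix v r'
    assume v: "v \<in> {l..r}" "v \<notin> S"
    then have lr: "l < v" "v < r" using assms by (auto simp: order_less_le)
    have two: "two v \<longleftrightarrow> v = w" using w[OF lr] .
    consider "v = w" | "v < w" | "w < v" by linarith
    then show "g (Suc r') v \<longleftrightarrow> g r' v \<or>
         (if two v then (g r' (v - 1) \<and> (lam \<le> r' \<longrightarrow> \<not> g (r' - lam) (v - 1)))
                     \<and> (g r' (Suc v) \<and> (lam \<le> r' \<longrightarrow> \<not> g (r' - lam) (Suc v)))
          else (g r' (v - 1) \<and> (lam \<le> r' \<longrightarrow> \<not> g (r' - lam) (v - 1)))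
                     \<or> (g r' (Suc v) \<and> (lam \<le> r' \<longrightarrow> \<not> g (r' - lam) (Suc v))))"
    proof cases
      case 1
      obtain a where a: "w = Suc (l + a)" using assms(3) less_iff_Suc_add by blast
      obtain b where b: "r = Suc (w + b)" using assms(4) less_iff_Suc_add by blast
      have g: "g k w \<longleftrightarrow> \<bar>int a - int b\<bar> < int lam \<and> Suc a \<le> k \<and> Suc b \<le> k"
        "g k (w - 1) \<longleftrightarrow> a \<le> k" "g k (Suc w) \<longleftrightarrow> b \<le> k" for k
        by (auto simp: g_def a b)
      \<comment> \<open>The neighbours are infected in rounds \<open>a\<close> and \<open>b\<close>,
        and each is active in the next \<open>lam\<close> rounds. These windows meet iff
        \<open>a\<close> and \<open>b\<close> differ by less than \<open>lam\<close>, first in round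
        \<open>max a b + 1\<close>.\<close>
      show ?thesis unfolding two using 1 by (simp add: g del: One_nat_def) arith
    next
      case 2
      obtain a where a: "v = Suc (l + a)" using lr(1) less_iff_Suc_add by blast
      \<comment> \<open>For the neighbour on the far side an implication suffices: it is never
        infected before \<open>v\<close>, so it cannot cause the infection of
        \<open>v\<close>.\<close>
      have g: "g k v \<longleftrightarrow> Suc a \<le> k" "g k (v - 1) \<longleftrightarrow> a \<le> k" "g k (Suc v) \<Longrightarrow> Suc a \<le> k" for k
        using 2 a by (auto simp: g_def split: if_splits)
      have "Suc a \<le> Suc r' \<longleftrightarrow> Suc a \<le> r' \<or> a \<le> r' \<and> (lam \<le> r' \<longrightarrow> \<not> a \<le> r' - lam)"
        using lam by arith
      then show ?thesis unfolding two using 2 g by (simp add: g(1,2) del: One_nat_def) blast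
    next
      case 3
      obtain b where b: "r = Suc (v + b)" using lr(2) less_iff_Suc_add by blast
      have g: "g k v \<longleftrightarrow> Suc b \<le> k" "g k (Suc v) \<longleftrightarrow> b \<le> k" "g k (v - 1) \<Longrightarrow> Suc b \<le> k" for k
        using 3 b by (auto simp: g_def split: if_splits)
      have "Suc b \<le> Suc r' \<longleftrightarrow> Suc b \<le> r' \<or> b \<le> r' \<and> (lam \<le> r' \<longrightarrow> \<not> b \<le> r' - lam)"
        using lam by arith
      then show ?thesis unfolding two using 3 g by (simp add: g(1,2) del: One_nat_def) blast
    qed
  next
    fix v r' assume "v \<in> {l..r}" "v \<in> S"
    then have "v = l \<or> v = r" using gap by (auto simp: order_less_le)
    then show "g r' v" using assms by (auto simp: g_def)
  next
    fix v assume v: "v \<in> {l..r}" "v \<notin> S"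
    then have lr: "l < v" "v < r" using assms by (auto simp: order_less_le)
    then show "\<not> g 0 v" "0 < v \<and> v - 1 \<in> {l..r} \<and> Suc v \<in> {l..r}"
      using assms by (auto simp: g_def)
  qed (use assms in auto)
  then show ?thesis by (simp add: g_def)
qed

text \<open>No node of the block can be infected first: inner nodes and ends of the path have all
  their neighbours inside the block, and a boundary node of threshold two has at least one of its
  two neighbours inside because \<open>a < b\<close>.\<close>

lemma infl_unhit_block:
  assumes ab: "a < b" "b < n" "a = 0 \<or> two a" "Suc b = n \<or> two b" and S: "S \<inter> {a..b} = {}"
  shows "infl (path_graph n) t lam S r \<inter> {a..b} = {}"
proof (induction r)
  case (Suc r)
  have False if v: "v \<in> {a..b}" "v \<in> infl (path_graph n) t lam S (Suc r)" for v
  proof -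
    have new: "v \<notin> infl (path_graph n) t lam S r" using v Suc.IH by blast
    have old: "u \<notin> act (path_graph n) t lam S (Suc r)" if "u \<in> {a..b}" for u
      using that Suc.IH unfolding act_iff by blast
    have "v < n" using v ab by simp
    show False
    proof (cases "two v")
      case True
      then have "v - 1 \<notin> {a..b}" "Suc v \<notin> {a..b}"
        using v(2) new old unfolding infl_Suc_path[OF \<open>v < n\<close>] by auto
      then show False using v(1) ab(1) by auto
    next
      case False
      then have "0 < v \<and> v - 1 \<notin> {a..b} \<or> Suc v < n \<and> Suc v \<notin> {a..b}"
        using v(2) new old unfolding infl_Suc_path[OF \<open>v < n\<close>] by auto
      then have "0 < v \<and> v = a \<or> Suc v < n \<and> v = b" using v(1) by auto
      then show False using ab False by auto
    qed
  qed
  then show ?case by blast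
qed (use S in simp)

section \<open>Target sets are exactly the spanning sets\<close>

lemma spans_if_target:
  assumes "S \<subseteq> {0..<n}" "0 < n" and target: "infl (path_graph n) t lam S k = {0..<n}"
  shows "spans two lam S"
proof -
  \<comment> \<open>Used below for blocks between an end of the path and a threshold-two node, and
    for blocks between two threshold-two nodes.\<close>
  have hit: "S \<inter> {a..b} \<noteq> {}" if "a < b" "b < n" "a = 0 \<or> two a" "Suc b = n \<or> two b" for a b
  proof
    assume "S \<inter> {a..b} = {}"
    then have "b \<notin> infl (path_graph n) t lam S k"
      using infl_unhit_block[OF that, of S k] that(1) by auto
    then show False using target that(2) by simp
  qed
  have "S \<noteq> {}"
  proof
    assume "S = {}"
    moreover have "infl (path_graph n) t lam {} r = {}" for r
    proof (induction r)
      case (Suc r)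
      have "v \<notin> infl (path_graph n) t lam {} (Suc r)" for v
      proof (cases "v < n")
        case True
        show ?thesis unfolding infl_Suc_path[OF True] act_iff using Suc.IH by simp
      next
        case False
        then show ?thesis using infl_verts[of "{}" "path_graph n" t lam "Suc r"] by auto
      qed
      then show ?case by blast
    qed simp
    ultimately show False using target assms(2) by simp
  qed
  moreover have "(\<exists>s\<in>S. s \<le> v) \<and> (\<exists>s\<in>S. v \<le> s)" if v: "two v" for v
  proof -
    have "S \<inter> {0..v} \<noteq> {}" "S \<inter> {v..n - 1} \<noteq> {}"
      using hit[of 0 v] hit[of v "n - 1"] two_inner[OF v] v by auto
    then show ?thesis by auto
  qed
  moreover have "hop two lam l r"
    if lr: "l \<in> S" "r \<in> S" "l < r" and gap: "\<And>x. l < x \<Longrightarrow> x < r \<Longrightarrow> x \<notin> S" for l r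
  proof -
    have "r < n" using lr assms(1) by auto
    have no2: False if "l < a" "a < b" "b < r" "two a" "two b" for a b
    proof -
      have "S \<inter> {a..b} \<noteq> {}" using hit[of a b] that \<open>r < n\<close> by simp
      then obtain x where "x \<in> S" "a \<le> x" "x \<le> b" by auto
      then show False using gap[of x] that by simp
    qed
    have one: "w = v" if "l < v" "v < r" "two v" "l < w" "w < r" "two w" for v w
      using no2[of v w] no2[of w v] that by (metis linorder_neqE_nat)
    have "\<bar>int l + int r - 2 * int v\<bar> < int lam" if v: "l < v" "v < r" "two v" for v
    proof -
      have "v \<in> infl (path_graph n) t lam S k" using target v \<open>r < n\<close> by simp
      then show ?thesis
        using infl_between_seeds[OF lr(1,2) v(1,2) \<open>r < n\<close> gap] one v by blast
    qed
    then show ?thesis using lr one by (auto simp: hop_def)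
  qed
  ultimately show ?thesis unfolding spans_def by blast
qed

lemma spans_infl_two:
  assumes S: "S \<subseteq> {0..<n}" and sp: "spans two lam S" and v: "two v"
  shows "\<exists>k. v \<in> infl (path_graph n) t lam S k"
proof (cases "v \<in> S")
  case True
  show ?thesis using infl_seed[OF True] by (rule exI)
next
  case False
  obtain s s' where "s \<in> S" "s \<le> v" "s' \<in> S" "v \<le> s'"
    using sp v unfolding spans_def by blast
  then have s: "s \<in> S" "s < v" "s' \<in> S" "v < s'" using False by (auto simp: order_less_le)
  obtain l where l: "l \<in> S" "l < v" "\<And>x. l < x \<Longrightarrow> x < v \<Longrightarrow> x \<notin> S"
    using Max_lt_obtain[OF s(1,2)] by blast
  obtain r where r: "r \<in> S" "v < r" "\<And>x. v < x \<Longrightarrow> x < r \<Longrightarrow> x \<notin> S"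
    using Min_gt_obtain[OF s(3,4)] by blast
  have gap: "x \<notin> S" if "l < x" "x < r" for x
    using l(3)[of x] r(3)[of x] False that by (cases x v rule: linorder_cases) auto
  then have hop: "hop two lam l r"
    using sp l(1) r(1) less_trans[OF l(2) r(2)] unfolding spans_def by simp
  have "\<bar>int l + int r - 2 * int v\<bar> < int lam" "\<And>x. l < x \<Longrightarrow> x < r \<Longrightarrow> two x \<longleftrightarrow> x = v"
    using hop v l(2) r(2) unfolding hop_def by auto
  moreover have "r < n" using r S by auto
  \<comment> \<open>The sum of the two distances is a round by which both infections have
    arrived.\<close>
  ultimately have "v \<in> infl (path_graph n) t lam S (v - l + (r - v))"
    using infl_between_seeds[OF l(1) r(1) l(2) r(2) _ gap] by simp
  then show ?thesis by blast
qed

lemma spans_infl_all: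
  assumes S: "S \<subseteq> {0..<n}" and sp: "spans two lam S" and "v < n"
  shows "\<exists>k. v \<in> infl (path_graph n) t lam S k"
proof -
  text \<open>The nearest node on either side that is a seed or has threshold two is infected at
    some time, and from there the infection spreads over nodes of threshold one.\<close>
  define C where "C = S \<union> {w. two w}"
  have C: "c < n \<and> (\<exists>k. c \<in> infl (path_graph n) t lam S k)" if "c \<in> C" for c
    using that S spans_infl_two[OF S sp] infl_seed[of c S "path_graph n" t lam] unfolding C_def two_def
    by auto
  obtain s where "s \<in> S" using sp unfolding spans_def by blast
  then have "s \<in> C" by (simp add: C_def)
  consider "v \<in> C" | "v \<notin> C" "s < v" | "v \<notin> C" "v < s"
    using \<open>s \<in> C\<close> by (metis linorder_neqE_nat)
  then show ?thesis
  proof cases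
    case 1
    then show ?thesis using C by blast
  next
    case 2
    then obtain l where l: "l \<in> C" "l < v" "\<And>x. l < x \<Longrightarrow> x < v \<Longrightarrow> x \<notin> C"
      using Max_lt_obtain[OF \<open>s \<in> C\<close>] by metis
    then obtain k where k: "l \<in> infl (path_graph n) t lam S k" using C by blast
    have "\<not> two x" if "l < x" "x \<le> l + (v - l)" for x
      using l that 2 by (cases "x = v") (auto simp: C_def)
    then have "l + (v - l) \<in> infl (path_graph n) t lam S (k + (v - l))"
      using l(2) \<open>v < n\<close> by (intro infl_spread_right[OF k]) simp_all
    then show ?thesis using l by auto
  next
    case 3
    then obtain r where r: "r \<in> C" "v < r" "\<And>x. v < x \<Longrightarrow> x < r \<Longrightarrow> x \<notin> C"
      using Min_gt_obtain[OF \<open>s \<in> C\<close>] by metis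
    then obtain k where k: "r \<in> infl (path_graph n) t lam S k" using C by blast
    have "\<not> two x" if "r - (r - v) \<le> x" "x < r" for x
      using r that 3 by (cases "x = v") (auto simp: C_def)
    moreover have "r < n" using C[OF r(1)] by simp
    ultimately have "r - (r - v) \<in> infl (path_graph n) t lam S (k + (r - v))"
      by (intro infl_spread_left[OF k]) simp_all
    then show ?thesis using r by auto
  qed
qed

lemma target_if_spans:
  assumes S: "S \<subseteq> {0..<n}" and sp: "spans two lam S"
  shows "\<exists>k. infl (path_graph n) t lam S k = {0..<n}"
proof -
  obtain k where k: "\<And>v. v < n \<Longrightarrow> v \<in> infl (path_graph n) t lam S (k v)"
    using spans_infl_all[OF S sp] by metis
  \<comment> \<open>The sum bounds each single \<open>k v\<close>, which gives one round for all
    nodes.\<close>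
  have "v \<in> infl (path_graph n) t lam S (\<Sum>v<n. k v)" if "v < n" for v
    using k[OF that] infl_mono[OF member_le_sum[of v "{..<n}" k], of "path_graph n" t lam S] that by auto
  then have "infl (path_graph n) t lam S (\<Sum>v<n. k v) = {0..<n}"
    using infl_verts[of S "path_graph n" t lam "\<Sum>v<n. k v"] S by auto
  then show ?thesis by (rule exI)
qed

lemma twc_target_set_iff:
  "0 < n \<Longrightarrow> twc_target_set (path_graph n) t lam S \<longleftrightarrow> S \<subseteq> {0..<n} \<and> spans two lam S"
  using spans_if_target[of S] target_if_spans[of S] unfolding twc_target_set_def verts_path by blast

end

section \<open>Minimum spanning sets of positions\<close>

text \<open>Positions are counted from 1, so that 0 can stand for "no such position".\<close>

locale positions =
  fixes T :: "nat \<Rightarrow> bool" and lam :: nat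
  assumes T0: "\<not> T 0"
begin

section \<open>The cost recursion over threshold-two positions\<close>

fun prev :: "nat \<Rightarrow> nat" where
  "prev 0 = 0"
| "prev (Suc y) = (if T y then y else prev y)"

lemma prev_less: "0 < y \<Longrightarrow> prev y < y"
  by (induction y) (auto simp: less_Suc_eq)

lemma prev_le: "prev y \<le> y"
  by (induction y) auto

lemma prev_lt: "0 < prev y \<Longrightarrow> prev y < y"
  using prev_less[of y] by (cases y) auto

lemma T_prev: "0 < prev y \<Longrightarrow> T (prev y)"
  by (induction y) (auto split: if_splits)

lemma prev_greatest: "T v \<Longrightarrow> v < y \<Longrightarrow> v \<le> prev y"
  by (induction y) (auto simp: less_Suc_eq prev_le)

lemma prev_unique: "T p \<Longrightarrow> p < y \<Longrightarrow> (\<And>v. T v \<Longrightarrow> v < y \<Longrightarrow> v \<le> p) \<Longrightarrow> prev y = p"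
proof -
  assume p: "T p" "p < y" and g: "\<And>v. T v \<Longrightarrow> v < y \<Longrightarrow> v \<le> p"
  have le: "p \<le> prev y" using p by (rule prev_greatest)
  have "p \<noteq> 0" using p T0 by metis
  then show "prev y = p" using le g[of "prev y"] T_prev[of y] prev_lt[of y] by simp
qed

text \<open>The least number \<open>cost y\<close> of seeds up to \<open>y\<close> when \<open>y\<close> is a seed exceeds \<open>cost (prev y)\<close> by 0 or 1,
  and \<open>saves y\<close> says that the excess is 0.  Then \<open>y\<close> is reached by jumping over \<open>prev y\<close> from a
  position of cost \<open>cost (prev y) - 1\<close>; these positions are \<open>prev (prev y)\<close> and the saving
  positions between it and \<open>prev y\<close>, and there are none if \<open>prev y\<close> is itself saving.\<close>

function saves :: "nat \<Rightarrow> bool" where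
  "saves y = (if 0 < prev y \<and> 0 < prev (prev y) then \<not> saves (prev y) \<and>
     (\<exists>l\<in>{prev (prev y)..<prev y}. (l = prev (prev y) \<or> saves l) \<and>
        \<bar>int l + int y - 2 * int (prev y)\<bar> < int lam) else False)"
  by auto
termination
  by (relation "measure id") (auto simp: prev_lt intro: less_le_trans[OF _ prev_le])

declare saves.simps [simp del]

function cost :: "nat \<Rightarrow> nat" where
  "cost y = (if prev y = 0 then 1 else cost (prev y) + (if saves y then 0 else 1))"
  by auto
termination
  by (relation "measure id") (auto simp: prev_lt)

declare cost.simps [simp del]

lemma cost_pos: "1 \<le> cost y"
  by (induction y rule: cost.induct) (metis One_nat_def cost.simps le_add1 le_refl le_trans not_gr0)

text \<open>No threshold-two position lies strictly between \<open>prev r\<close> and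
  \<open>r\<close>, so a position \<open>l\<close> there has the same predecessor as
  \<open>r\<close>.\<close>

lemma prev_cases: assumes "prev r \<le> l" "l < r" shows "prev r = l \<or> prev r = prev l"
proof (cases "prev r = l")
  case False
  then have lt: "prev r < l" using assms by simp
  show ?thesis
  proof (cases "prev r = 0")
    case True
    then have "prev l = 0"
      using T_prev[of l] prev_greatest[of "prev l" r] prev_le[of l] assms by fastforce
    then show ?thesis using True by simp
  next
    case False
    have "prev l = prev r"
      using T_prev[of r] False lt prev_greatest[of _ r] assms(2)
      by (intro prev_unique) auto
    then show ?thesis by simp
  qed
qed simp

text \<open>The only threshold-two position a hop to \<open>r\<close> can jump over is
  \<open>prev r\<close>; jumping over \<open>prev (prev r)\<close> as well would make two. This
  replaces the quantifiers in \<open>hop\<close> by a few comparisons.\<close>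

lemma hop_prev_iff:
  "hop T lam l r \<longleftrightarrow> l < r \<and> (prev r \<le> l \<or>
     prev (prev r) \<le> l \<and> \<bar>int l + int r - 2 * int (prev r)\<bar> < int lam)"
proof (cases "l < r \<and> l < prev r")
  case True
  then have p: "0 < prev r" "prev r < r" "T (prev r)" using prev_less[of r] T_prev[of r] by auto
  show ?thesis
  proof
    assume h: "hop T lam l r"
    have "prev (prev r) \<le> l"
    proof (rule ccontr)
      assume "\<not> prev (prev r) \<le> l"
      then have q: "l < prev (prev r)" by simp
      then have "T (prev (prev r))" "prev (prev r) < prev r"
        using T_prev[of "prev r"] prev_less[OF p(1)] by auto
      then show False using h q True p unfolding hop_def by (metis less_irrefl less_trans)
    qed
    then show "l < r \<and> (prev r \<le> l \<or>
     prev (prev r) \<le> l \<and> \<bar>int l + int r - 2 * int (prev r)\<bar> < int lam)"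
      using h p True unfolding hop_def by blast
  next
    assume r: "l < r \<and> (prev r \<le> l \<or>
     prev (prev r) \<le> l \<and> \<bar>int l + int r - 2 * int (prev r)\<bar> < int lam)"
    have "v = prev r" if "l < v" "v < r" "T v" for v
      using prev_greatest[OF that(3,2)] prev_greatest[OF that(3), of "prev r"] r that(1) True
      by (metis le_neq_implies_less not_le order_trans)
    then show "hop T lam l r" using r True unfolding hop_def by auto
  qed
next
  case False
  have "hop T lam l r" if "l < r" "prev r \<le> l"
    using that prev_greatest[of _ r] unfolding hop_def by (meson leD order_trans)
  then show ?thesis using False unfolding hop_def by auto
qed

lemma cost_hop_near: assumes "1 \<le> l" "prev r \<le> l" "l < r" shows "cost r \<le> cost l + 1"
  using prev_cases[OF assms(2,3)]
proof
  assume "prev r = l"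
  then show ?thesis using assms by (subst cost.simps) auto
next
  assume "prev r = prev l"
  then show ?thesis using cost_pos[of l] cost.simps[of r] cost.simps[of l] by (auto split: if_splits)
qed

text \<open>The inequality behind optimality. The critical hop jumps over \<open>p = prev r\<close>
  from an \<open>l\<close> with \<open>cost l < cost p\<close>. Then \<open>p\<close> is not saving,
  and \<open>l\<close> is \<open>prev p\<close> or saving, which is just what makes \<open>r\<close>
  saving, so \<open>cost r = cost p\<close>.\<close>

lemma cost_hop:
  assumes "1 \<le> l" and h: "hop T lam l r"
  shows "cost r \<le> cost l + 1"
proof (cases "prev r \<le> l")
  case True
  then show ?thesis using cost_hop_near assms unfolding hop_def by blast
next
  case False
  define p where "p = prev r"
  define q where "q = prev p"
  have l: "l < p" "q \<le> l" "l < r" "\<bar>int l + int r - 2 * int p\<bar> < int lam"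
    using h False unfolding hop_prev_iff p_def q_def by auto
  have cr: "cost r = cost p + (if saves r then 0 else 1)"
    using l by (subst cost.simps) (simp add: p_def)
  have cp: "cost p \<le> cost l + 1"
    using cost_hop_near[OF assms(1)] l unfolding q_def by blast
  show ?thesis
  proof (cases "cost l < cost p")
    case True
    \<comment> \<open>Otherwise \<open>cost p\<close> would be 1, the least possible cost, and
      \<open>cost l\<close> could not be smaller.\<close>
    have "q \<noteq> 0"
    proof
      assume "q = 0"
      then have "cost p = 1" by (subst cost.simps) (simp add: q_def)
      then show False using True cost_pos[of l] by simp
    qed
    have cp2: "cost p = cost q + (if saves p then 0 else 1)"
      using \<open>q \<noteq> 0\<close> by (subst cost.simps) (simp add: q_def)
    have "l = q \<or> q = prev l" using prev_cases[of p l] l unfolding q_def by auto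
    then have cl: "l = q \<or> cost l = cost q + (if saves l then 0 else 1)"
      using \<open>q \<noteq> 0\<close> by (metis cost.simps)
    have "\<not> saves p" "l = q \<or> saves l"
      using cl cp2 True by (auto split: if_splits)
    then have "saves r"
      using l \<open>q \<noteq> 0\<close> by (subst saves.simps) (auto simp: p_def[symmetric] q_def[symmetric])
    then show ?thesis using cr cp by simp
  qed (use cr cp in auto)
qed

section \<open>Deciding a saving by one table lookup\<close>

text \<open>Threshold-two positions are included so that, from \<open>prev (prev y)\<close> up to
  but excluding \<open>prev y\<close>, the low positions are exactly the candidates in
  \<open>saves y\<close>.\<close>

definition low :: "nat \<Rightarrow> bool" where
  "low l \<longleftrightarrow> T l \<or> saves l"

fun last_low :: "nat \<Rightarrow> nat" where
  "last_low 0 = 0"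
| "last_low (Suc x) = (if low (Suc x) then Suc x else last_low x)"

lemma last_low_le: "last_low x \<le> x"
  by (induction x) auto

lemma low_last_low: "0 < last_low x \<Longrightarrow> low (last_low x)"
  by (induction x) (auto split: if_splits)

lemma last_low_greatest: "low l \<Longrightarrow> l \<le> x \<Longrightarrow> l \<le> last_low x"
proof (induction x)
  case 0
  then show ?case by simp
next
  case (Suc x)
  then show ?case by (auto simp: le_Suc_eq)
qed

text \<open>The left end of the interval of candidates. When no saving is possible it is set to
  \<open>prev y\<close>, which exceeds \<open>reach y\<close>, so that the interval becomes
  empty.\<close>

definition from_pos :: "nat \<Rightarrow> nat" where
  "from_pos y = (if prev (prev y) = 0 \<or> saves (prev y) then prev y else prev (prev y))"

text \<open>The right end: the largest \<open>l\<close> with \<open>l < prev y\<close> and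
  \<open>l + y - 2 * prev y < lam\<close>. It is an integer because it may be negative.\<close>

definition reach :: "nat \<Rightarrow> int" where
  "reach y = min (int (prev y) - 1) (2 * int (prev y) - int y + int lam - 1)"

lemma reach_less: "reach y < int (prev y)"
  by (simp add: reach_def)

text \<open>Once \<open>l\<close> is bounded above by \<open>reach y\<close>, the other conditions
  on it are lower bounds. So if any low position qualifies, the last one up to
  \<open>reach y\<close> does.\<close>

lemma saves_iff:
  "saves y \<longleftrightarrow> int (from_pos y) \<le> reach y \<and>
     2 * int (prev y) - int y - int lam < int (last_low (nat (reach y)))"
proof (cases "prev (prev y) = 0 \<or> saves (prev y)")
  case True
  then show ?thesis using reach_less[of y] by (subst saves.simps) (auto simp: from_pos_def)
next
  case False
  define p where "p = prev y"
  define q where "q = prev p"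
  define i where "i = nat (reach y)"
  have q: "0 < q" "\<not> saves p" using False by (auto simp: p_def q_def)
  have "0 < p" using q(1) prev_le[of p] by (simp add: q_def)
  have "T q" "q < p" using T_prev[of p] prev_less[of p] q \<open>0 < p\<close> by (auto simp: q_def)
  have f: "from_pos y = q" using False by (auto simp: from_pos_def p_def q_def)
  have s: "saves y \<longleftrightarrow> (\<exists>l\<in>{q..<p}. (l = q \<or> saves l) \<and> \<bar>int l + int y - 2 * int p\<bar> < int lam)"
    using q \<open>0 < p\<close> by (subst saves.simps) (simp add: p_def[symmetric] q_def[symmetric])
  have low: "low l \<longleftrightarrow> l = q \<or> saves l" if "q \<le> l" "l < p" for l
    using that \<open>T q\<close> prev_greatest[of l p] by (auto simp: low_def q_def)
  have r: "reach y = min (int p - 1) (2 * int p - int y + int lam - 1)" by (simp add: reach_def p_def)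
  show ?thesis unfolding f p_def[symmetric] i_def[symmetric]
  proof
    assume "saves y"
    then obtain l where l: "q \<le> l" "l < p" "low l" "\<bar>int l + int y - 2 * int p\<bar> < int lam"
      unfolding s using low by (metis atLeastLessThan_iff)
    then have "int l \<le> reach y" unfolding r by linarith
    then have "l \<le> i" "int q \<le> reach y" using l(1) by (auto simp: i_def)
    moreover have "l \<le> last_low i" using last_low_greatest l(3) \<open>l \<le> i\<close> by blast
    ultimately show "int q \<le> reach y \<and> 2 * int p - int y - int lam < int (last_low i)"
      using l(4) by linarith
  next
    assume a: "int q \<le> reach y \<and> 2 * int p - int y - int lam < int (last_low i)"
    then have i: "int i = reach y" "q \<le> i" by (auto simp: i_def)
    have "q \<le> last_low i" using last_low_greatest[of q i] low[of q] \<open>q < p\<close> i by simp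
    moreover have "last_low i \<le> i" by (rule last_low_le)
    moreover have "i < p" using i(1) reach_less[of y] by (simp add: p_def)
    moreover have "low (last_low i)" using low_last_low q calculation by simp
    ultimately show "saves y"
      unfolding s using low[of "last_low i"] a i r
      by (intro bexI[of _ "last_low i"]) auto
  qed
qed

section \<open>Optimal predecessors and the chain of seeds\<close>

definition pred :: "nat \<Rightarrow> nat" where
  "pred y = (if saves y then last_low (nat (reach y)) else prev y)"

lemma saves_prev_pos: "saves y \<Longrightarrow> 0 < prev y" "saves y \<Longrightarrow> 0 < prev (prev y)" "saves y \<Longrightarrow> \<not> saves (prev y)"
  using saves.simps[of y] by (auto split: if_splits)

text \<open>In the saving case the looked-up \<open>l\<close> is either
  \<open>q = prev (prev y)\<close> or a saving position with \<open>prev l = q\<close>, so it costs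
  \<open>cost q\<close>; and \<open>prev y\<close>, not being saving, costs one more, as does
  \<open>y\<close>.\<close>

lemma pred_hop:
  assumes "0 < prev y"
  shows "0 < pred y \<and> hop T lam (pred y) y \<and> cost y = cost (pred y) + 1"
proof (cases "saves y")
  case False
  then have "pred y = prev y" by (simp add: pred_def)
  moreover have "prev y < y" using assms prev_less[of y] by (cases y) auto
  ultimately show ?thesis using assms False
    by (subst (1) cost.simps) (simp add: hop_prev_iff)
next
  case True
  define p where "p = prev y"
  define q where "q = prev p"
  define l where "l = pred y"
  note s = saves_prev_pos[OF True, folded p_def, folded q_def]
  have f: "from_pos y = q" using s by (simp add: from_pos_def p_def q_def)
  have l': "l = last_low (nat (reach y))" using True by (simp add: l_def pred_def)
  have a: "int q \<le> reach y" "2 * int p - int y - int lam < int l"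
    using True unfolding saves_iff[of y] f l' by (auto simp: p_def)
  have "T q" using T_prev[of p] s by (simp add: q_def)
  then have "q \<le> l" unfolding l' using a(1) by (intro last_low_greatest) (auto simp: low_def)
  have "l \<le> nat (reach y)" unfolding l' by (rule last_low_le)
  then have lr: "int l \<le> reach y" using a(1) by linarith
  then have "l < p" "int l < 2 * int p - int y + int lam" unfolding reach_def p_def by auto
  have "p \<le> y" unfolding p_def by (rule prev_le)
  have hop: "hop T lam l y"
    unfolding hop_prev_iff p_def[symmetric] q_def[symmetric]
    using \<open>q \<le> l\<close> \<open>l < p\<close> \<open>p \<le> y\<close> a(2) \<open>int l < 2 * int p - int y + int lam\<close> by auto
  have "cost y = cost p" using True s by (subst cost.simps) (simp add: p_def)
  moreover have "cost p = cost q + 1" using s by (subst cost.simps) (simp add: q_def)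
  moreover have "cost l = cost q"
  proof (cases "l = q")
    case False
    then have "q < l" using \<open>q \<le> l\<close> by simp
    then have "low l" using low_last_low l' s by simp
    moreover have "\<not> T l" using prev_greatest[of l p] \<open>l < p\<close> \<open>q < l\<close> by (auto simp: q_def)
    ultimately have "saves l" by (simp add: low_def)
    moreover have "prev l = q" using prev_cases[of p l] \<open>l < p\<close> \<open>q < l\<close> by (simp add: q_def)
    ultimately show ?thesis using s by (subst cost.simps) simp
  qed simp
  ultimately show ?thesis using hop \<open>q \<le> l\<close> s by (simp add: l_def)
qed

lemma pred_less: "0 < y \<Longrightarrow> pred y < y"
proof -
  assume "0 < y"
  show ?thesis
  proof (cases "0 < prev y")
    case True
    then show ?thesis using pred_hop by (simp add: hop_def)
  next
    case False
    then show ?thesis using \<open>0 < y\<close> saves_prev_pos(1)[of y] by (auto simp: pred_def)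
  qed
qed

function chain :: "nat \<Rightarrow> nat set" where
  "chain y = (if y = 0 then {} else insert y (chain (pred y)))"
  by auto
termination
  by (relation "measure id") (auto simp: pred_less)

declare chain.simps [simp del]

lemma chain_0 [simp]: "chain 0 = {}"
  by (simp add: chain.simps)

lemma chain_pos: "0 < y \<Longrightarrow> chain y = insert y (chain (pred y))"
  by (subst chain.simps) simp

lemma pred_eq_0: "prev y = 0 \<Longrightarrow> pred y = 0"
  using saves_prev_pos(1)[of y] by (auto simp: pred_def)

lemma chain_range: "chain y \<subseteq> {1..y}"
proof (induction y rule: less_induct)
  case (less y)
  show ?case
  proof (cases "y = 0")
    case False
    then have y: "pred y < y" by (simp add: pred_less)
    then have "chain (pred y) \<subseteq> {1..y}" using less[OF y] by auto
    then show ?thesis using False chain_pos[of y] by simp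
  qed simp
qed

lemma card_chain: "0 < y \<Longrightarrow> card (chain y) = cost y"
proof (induction y rule: less_induct)
  case (less y)
  have fin: "finite (chain x)" for x using finite_subset[OF chain_range] by simp
  have "y \<notin> chain (pred y)" using chain_range[of "pred y"] pred_less[OF less.prems] by auto
  then have c: "card (chain y) = Suc (card (chain (pred y)))"
    using chain_pos[OF less.prems] fin by simp
  show ?case
  proof (cases "prev y = 0")
    case True
    then show ?thesis using c pred_eq_0 by (subst cost.simps) simp
  next
    case False
    then show ?thesis using c pred_hop[of y] less.IH[of "pred y"] pred_less[OF less.prems] by simp
  qed
qed

text \<open>The form of \<open>spans\<close> that survives induction: nothing is required yet to the
  right of \<open>y\<close>. The first element of the chain has no threshold-two position before
  it.\<close>

lemma chain_spans_upto:
  assumes "0 < y"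
  shows "y \<in> chain y \<and> (\<forall>v. T v \<and> v \<le> y \<longrightarrow> (\<exists>s\<in>chain y. s \<le> v)) \<and>
     (\<forall>l\<in>chain y. \<forall>r\<in>chain y. l < r \<and> (\<forall>x. l < x \<and> x < r \<longrightarrow> x \<notin> chain y) \<longrightarrow> hop T lam l r)"
  using assms
proof (induction y rule: less_induct)
  case (less y)
  define l where "l = pred y"
  have ch: "chain y = insert y (chain l)" using chain_pos[OF less.prems] by (simp add: l_def)
  show ?case
  proof (cases "prev y = 0")
    case True
    then have "chain y = {y}" using ch pred_eq_0[of y] by (simp add: l_def)
    moreover have "v = y" if "T v" "v \<le> y" for v
      using prev_greatest[of v y] that True T0 by (metis le_neq_implies_less le_zero_eq)
    ultimately show ?thesis by auto
  next
    case False
    then have l: "0 < l" "hop T lam l y" "l < y" using pred_hop[of y] by (auto simp: l_def hop_def)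
    note IH = less.IH[OF l(3,1)]
    have sub: "chain l \<subseteq> {1..l}" by (rule chain_range)
    have "\<exists>s\<in>chain y. s \<le> v" if "T v" "v \<le> y" for v
      using IH ch that by (cases "v \<le> l") (auto intro: bexI[of _ l])
    moreover have "hop T lam a b"
      if ab: "a \<in> chain y" "b \<in> chain y" "a < b" and gap: "\<forall>x. a < x \<and> x < b \<longrightarrow> x \<notin> chain y" for a b
    proof (cases "b = y")
      case True
      then have "a \<in> chain l" using ab ch by auto
      then have "a \<le> l" using sub by auto
      moreover have "l \<in> chain y" using IH ch by simp
      ultimately have "a = l" using gap True l(3) by (metis le_neq_implies_less)
      then show ?thesis using True l by simp
    next
      case False
      then have "b \<in> chain l" using ab ch by auto
      then have "b \<le> l" using sub by auto
      then have "a \<in> chain l" using ab ch l(3) by auto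
      then show ?thesis using IH \<open>b \<in> chain l\<close> ab(3) gap ch by simp
    qed
    ultimately show ?thesis using ch by blast
  qed
qed

section \<open>Optimality of the chain\<close>

text \<open>\<open>Suc n\<close> makes the strict \<open>prev\<close> include position
  \<open>n\<close>. Without threshold-two positions one seed is still required, and position 1 is
  chosen.\<close>

definition goal_pos :: "nat \<Rightarrow> nat" where
  "goal_pos n = (if prev (Suc n) = 0 then 1 else prev (Suc n))"

lemma goal_pos_range: "1 \<le> n \<Longrightarrow> 1 \<le> goal_pos n \<and> goal_pos n \<le> n"
  using prev_less[of "Suc n"] by (auto simp: goal_pos_def)

lemma spans_chain:
  assumes "\<And>v. T v \<Longrightarrow> v \<le> n"
  shows "spans T lam (chain (goal_pos n))"
proof -
  have "0 < goal_pos n" by (simp add: goal_pos_def)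
  note c = chain_spans_upto[OF this]
  have "v \<le> goal_pos n" if "T v" for v
    using prev_greatest[OF that, of "Suc n"] assms[OF that] that T0
    unfolding goal_pos_def by (auto simp: less_Suc_eq_le)
  then show ?thesis using c unfolding spans_def by blast
qed

text \<open>Along consecutive seeds each hop raises the cost by at most one
  (\<open>cost_hop\<close>), and the first seed, having no threshold-two position before it, costs
  1.\<close>

lemma cost_le_card:
  assumes S: "S \<subseteq> {1..}" "finite S" and sp: "spans T lam S" and "s \<in> S"
  shows "cost s \<le> card {x \<in> S. x \<le> s}"
  using \<open>s \<in> S\<close>
proof (induction s rule: less_induct)
  case (less s)
  show ?case
  proof (cases "\<exists>x\<in>S. x < s")
    case True
    then obtain x where "x \<in> S" "x < s" by blast
    then obtain l where l: "l \<in> S" "l < s" "\<And>x. l < x \<Longrightarrow> x < s \<Longrightarrow> x \<notin> S"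
      using Max_lt_obtain by blast
    have "hop T lam l s" using sp l less.prems unfolding spans_def by blast
    then have "cost s \<le> cost l + 1" using cost_hop[of l s] l(1) S by auto
    moreover have "{x \<in> S. x \<le> s} = insert s {x \<in> S. x \<le> l}"
      using l less.prems by (auto simp: not_le) (meson le_neq_implies_less not_le)
    then have "card {x \<in> S. x \<le> s} = card {x \<in> S. x \<le> l} + 1"
      using l(2) S(2) by simp
    ultimately show ?thesis using less.IH[OF l(2,1)] by linarith
  next
    case False
    have "prev s = 0"
    proof (rule ccontr)
      assume p: "prev s \<noteq> 0"
      then have "prev s < s" using prev_less[of s] by (cases s) auto
      moreover obtain x where "x \<in> S" "x \<le> prev s"
        using sp T_prev[of s] p unfolding spans_def by blast
      ultimately show False using False by (meson le_less_trans)
    qed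
    then have "cost s = 1" by (subst cost.simps) simp
    moreover have "0 < card {x \<in> S. x \<le> s}"
      using less.prems S(2) by (subst card_gt_0_iff) auto
    ultimately show ?thesis by simp
  qed
qed

text \<open>The largest seed lies at or beyond the last threshold-two position \<open>e\<close>. If
  it lies beyond, its \<open>prev\<close> is \<open>e\<close>, so its cost is at least
  \<open>cost e\<close>.\<close>

lemma card_chain_le:
  assumes S: "S \<subseteq> {1..n}" and sp: "spans T lam S"
  shows "card (chain (goal_pos n)) \<le> card S"
proof -
  have fin: "finite S" using S finite_subset by blast
  have "S \<noteq> {}" using sp by (simp add: spans_def)
  then have m: "Max S \<in> S" "\<And>x. x \<in> S \<Longrightarrow> x \<le> Max S" using fin by auto
  then have "cost (Max S) \<le> card {x \<in> S. x \<le> Max S}"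
    using cost_le_card[of S "Max S"] S fin sp by fastforce
  then have c: "cost (Max S) \<le> card S"
    using card_mono[OF fin, of "{x \<in> S. x \<le> Max S}"] by fastforce
  have "cost (goal_pos n) \<le> cost (Max S)"
  proof (cases "prev (Suc n) = 0")
    case True
    then have "cost (goal_pos n) = 1"
      unfolding goal_pos_def by (subst cost.simps) (use T0 in simp)
    then show ?thesis using cost_pos by simp
  next
    case False
    define e where "e = prev (Suc n)"
    have e: "T e" using T_prev[of "Suc n"] False by (simp add: e_def)
    have "e \<le> Max S" using sp e m(2) unfolding spans_def by (meson order_trans)
    have "cost e \<le> cost (Max S)"
    proof (cases "e = Max S")
      case False
      then have "e < Max S" using \<open>e \<le> Max S\<close> by simp
      moreover have "v \<le> e" if "T v" "v < Max S" for v
        using prev_greatest[OF that(1), of "Suc n"] that(2) m(1) S unfolding e_def by fastforce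
      ultimately have "prev (Max S) = e" using e by (intro prev_unique) auto
      then show ?thesis using False e T0 by (subst (2) cost.simps) auto
    qed simp
    then show ?thesis using False by (simp add: goal_pos_def e_def)
  qed
  then show ?thesis using c card_chain[of "goal_pos n"] by (simp add: goal_pos_def)
qed

end

section \<open>The program\<close>

text \<open>An upper bound instead of an exact number of steps lets branches of different lengths
  share one bound.\<close>

definition reaches :: "program \<Rightarrow> nat \<Rightarrow> (config \<Rightarrow> bool) \<Rightarrow> config \<Rightarrow> bool" where
  "reaches P T Q c \<longleftrightarrow> (\<exists>k\<le>T. Q (run P k c))"

lemma reaches_0: "Q c \<Longrightarrow> reaches P T Q c"
  unfolding reaches_def by (rule exI[of _ 0]) (simp add: run_def)

text \<open>Rule for symbolic execution: repeated use evaluates straight-line code on an explicit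
  configuration.\<close>

lemma reaches_exec:
  assumes "k < length P" "0 < T" "reaches P (T - 1) Q (exec (P ! k) \<lparr>pc = k, reg = r, mem = m\<rparr>)"
  shows "reaches P T Q \<lparr>pc = k, reg = r, mem = m\<rparr>"
proof -
  obtain j where j: "j \<le> T - 1" "Q (run P j (exec (P ! k) \<lparr>pc = k, reg = r, mem = m\<rparr>))"
    using assms(3) unfolding reaches_def by blast
  have "run P (Suc j) \<lparr>pc = k, reg = r, mem = m\<rparr> = run P j (exec (P ! k) \<lparr>pc = k, reg = r, mem = m\<rparr>)"
    using assms(1) by (simp add: run_def funpow_swap1 step_def halted_def)
  then show ?thesis unfolding reaches_def using j assms(2) by (intro exI[of _ "Suc j"]) simp
qed

lemma reaches_trans:
  assumes "reaches P T Q c" "\<And>c'. Q c' \<Longrightarrow> reaches P T' R c'"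
  shows "reaches P (T + T') R c"
proof -
  obtain j where j: "j \<le> T" "Q (run P j c)" using assms(1) unfolding reaches_def by blast
  obtain i where i: "i \<le> T'" "R (run P i (run P j c))" using assms(2)[OF j(2)] unfolding reaches_def by blast
  have "run P i (run P j c) = run P (i + j) c" by (simp add: run_def funpow_add)
  then show ?thesis unfolding reaches_def using i j by (intro exI[of _ "i + j"]) simp
qed

lemma reaches_mono: "reaches P T Q c \<Longrightarrow> T \<le> T' \<Longrightarrow> reaches P T' Q c"
  unfolding reaches_def by (meson order_trans)

lemma run_halted: "halted P c \<Longrightarrow> run P k c = c"
  by (induction k) (auto simp: run_def step_def)

text \<open>A halted configuration no longer changes, so the bound itself can serve as the running
  time.\<close>

lemma run_reaches_halted:
  assumes "reaches P T Q c" "\<And>c. Q c \<Longrightarrow> halted P c"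
  shows "Q (run P T c)"
proof -
  obtain k where k: "k \<le> T" "Q (run P k c)" using assms(1) unfolding reaches_def by blast
  have "run P T c = run P (T - k) (run P k c)"
    using k(1) by (simp add: run_def flip: funpow_add[THEN fun_cong, unfolded comp_def])
  then show ?thesis using run_halted[OF assms(2)[OF k(2)]] k(2) by simp
qed

text \<open>With the number \<open>n\<close> of nodes in register 0, \<open>last_low x\<close> is kept in cell \<open>n + x\<close> and
  \<open>pred x\<close> in cell \<open>2 n + 1 + x\<close>.  While position \<open>y\<close> is scanned, register 2 contains \<open>y\<close>,
  register 3 \<open>prev y\<close>, register 4 \<open>from_pos y\<close> and register 5 \<open>last_low (y - 1)\<close>.
  The scan (instructions 4 to 38) is followed by marking the chain (41 to 45).\<close>

definition prog :: program where
  "prog =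
    [Const 10 1, Add 15 0 0, Add 15 15 10, Const 2 1,
     JumpLess 0 2 39, Add 6 3 3, Sub 6 6 2, Add 7 6 1, Sub 7 7 10, Sub 9 3 10,
     JumpLess 7 9 12, Move 7 9,
     Move 8 3, Sub 12 2 10, Load 13 12, Store 12 11, Move 16 2, JumpLess 7 4 26,
     Add 9 0 7, Load 9 9, Sub 6 6 1, JumpLess 6 9 23, Jump 26,
     Move 8 9, Move 5 2, Jump 28,
     JumpLess 3 10 28, Move 16 3,
     JumpLess 10 13 30, Jump 33, Move 5 2, Move 4 16, Move 3 2,
     Add 9 0 2, Store 9 5, Add 9 15 2, Store 9 8, Add 2 2 10, Jump 4,
     JumpLess 11 3 41, Move 3 10,
     Sub 9 3 10, Store 9 10, Add 9 15 3, Load 3 9, JumpLess 11 3 41]"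

lemma length_prog: "length prog = 46"
  by (simp add: prog_def)

lemma prog_nth:
  "prog ! 0 = Const 10 1" "prog ! Suc 0 = Add 15 0 0" "prog ! 2 = Add 15 15 10" "prog ! 3 = Const 2 1"
  "prog ! 4 = JumpLess 0 2 39" "prog ! 5 = Add 6 3 3" "prog ! 6 = Sub 6 6 2" "prog ! 7 = Add 7 6 1"
  "prog ! 8 = Sub 7 7 10" "prog ! 9 = Sub 9 3 10" "prog ! 10 = JumpLess 7 9 12"
  "prog ! 11 = Move 7 9" "prog ! 12 = Move 8 3" "prog ! 13 = Sub 12 2 10" "prog ! 14 = Load 13 12"
  "prog ! 15 = Store 12 11" "prog ! 16 = Move 16 2" "prog ! 17 = JumpLess 7 4 26"
  "prog ! 18 = Add 9 0 7" "prog ! 19 = Load 9 9" "prog ! 20 = Sub 6 6 1"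
  "prog ! 21 = JumpLess 6 9 23" "prog ! 22 = Jump 26" "prog ! 23 = Move 8 9" "prog ! 24 = Move 5 2"
  "prog ! 25 = Jump 28" "prog ! 26 = JumpLess 3 10 28" "prog ! 27 = Move 16 3"
  "prog ! 28 = JumpLess 10 13 30" "prog ! 29 = Jump 33" "prog ! 30 = Move 5 2"
  "prog ! 31 = Move 4 16" "prog ! 32 = Move 3 2" "prog ! 33 = Add 9 0 2" "prog ! 34 = Store 9 5"
  "prog ! 35 = Add 9 15 2" "prog ! 36 = Store 9 8" "prog ! 37 = Add 2 2 10" "prog ! 38 = Jump 4"
  "prog ! 39 = JumpLess 11 3 41" "prog ! 40 = Move 3 10" "prog ! 41 = Sub 9 3 10"
  "prog ! 42 = Store 9 10" "prog ! 43 = Add 9 15 3" "prog ! 44 = Load 3 9"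
  "prog ! 45 = JumpLess 11 3 41"
  by (simp_all add: prog_def)

lemma exec_config:
  "exec (Const i z) \<lparr>pc = k, reg = r, mem = m\<rparr> = \<lparr>pc = k + 1, reg = r(i := z), mem = m\<rparr>"
  "exec (Move i j) \<lparr>pc = k, reg = r, mem = m\<rparr> = \<lparr>pc = k + 1, reg = r(i := r j), mem = m\<rparr>"
  "exec (Add i j l) \<lparr>pc = k, reg = r, mem = m\<rparr> = \<lparr>pc = k + 1, reg = r(i := r j + r l), mem = m\<rparr>"
  "exec (Sub i j l) \<lparr>pc = k, reg = r, mem = m\<rparr> = \<lparr>pc = k + 1, reg = r(i := r j - r l), mem = m\<rparr>"
  "exec (Load i j) \<lparr>pc = k, reg = r, mem = m\<rparr> = \<lparr>pc = k + 1, reg = r(i := m (nat (r j))), mem = m\<rparr>"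
  "exec (Store i j) \<lparr>pc = k, reg = r, mem = m\<rparr> = \<lparr>pc = k + 1, reg = r, mem = m(nat (r i) := r j)\<rparr>"
  "exec (Jump l) \<lparr>pc = k, reg = r, mem = m\<rparr> = \<lparr>pc = l, reg = r, mem = m\<rparr>"
  "exec (JumpLess i j l) \<lparr>pc = k, reg = r, mem = m\<rparr> =
     \<lparr>pc = if r i < r j then l else k + 1, reg = r, mem = m\<rparr>"
  by simp_all

section \<open>Correctness of the scan\<close>

locale path_program =
  fixes n lam :: nat and t :: "nat \<Rightarrow> nat"
  assumes n: "1 \<le> n"
begin

definition T :: "nat \<Rightarrow> bool" where
  "T v \<longleftrightarrow> 0 < v \<and> v \<le> n \<and> 1 < t (v - 1)"

sublocale positions T lam
  by unfold_locales (simp add: T_def)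

text \<open>Threshold cells are cleared as soon as they have been read, so that after the scan only
  the ones of the output remain to be written.\<close>

definition scan_mem :: "nat \<Rightarrow> (nat \<Rightarrow> int) \<Rightarrow> bool" where
  "scan_mem y m \<longleftrightarrow> (\<forall>x<n. m x = (if Suc x < y then 0 else int (t x))) \<and>
     (\<forall>x\<in>{1..<y}. m (n + x) = int (last_low x) \<and> m (2 * n + 1 + x) = int (pred x))"

definition scan_regs :: "nat \<Rightarrow> (nat \<Rightarrow> int) \<Rightarrow> bool" where
  "scan_regs y r \<longleftrightarrow> r 0 = int n \<and> r 1 = int lam \<and> r 2 = int y \<and> r 3 = int (prev y) \<and>
     r 4 = int (from_pos y) \<and> r 10 = 1 \<and> r 11 = 0 \<and> r 15 = 2 * int n + 1"

definition scanned :: "nat \<Rightarrow> config \<Rightarrow> bool" where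
  "scanned y c \<longleftrightarrow> pc c = 4 \<and> scan_regs y (reg c) \<and> reg c 5 = int (last_low (y - 1)) \<and> scan_mem y (mem c)"

text \<open>State in the middle of an iteration: it is decided whether \<open>y\<close> saves, but
  not yet whether it has threshold two. Register 16 holds the value of
  \<open>from_pos (Suc y)\<close> for the case that it has.\<close>

definition classified :: "nat \<Rightarrow> config \<Rightarrow> bool" where
  "classified y c \<longleftrightarrow> pc c = 28 \<and> scan_regs y (reg c) \<and>
     reg c 5 = int (if saves y then y else last_low (y - 1)) \<and> reg c 8 = int (pred y) \<and>
     reg c 13 = int (t (y - 1)) \<and> reg c 16 = int (if prev y = 0 \<or> saves y then y else prev y) \<and>
     (\<exists>m. scan_mem y m \<and> mem c = m(y - 1 := 0))"

lemma reaches_classified: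
  assumes y: "1 \<le> y" "y \<le> n" and c: "scanned y c"
  shows "reaches prog 30 (classified y) c"
proof -
  obtain r m where c': "c = \<lparr>pc = 4, reg = r, mem = m\<rparr>"
    using c unfolding scanned_def by (cases c) auto
  have r: "r 0 = int n" "r 1 = int lam" "r 2 = int y" "r 3 = int (prev y)" "r 4 = int (from_pos y)"
    "r (Suc 0) = int lam" "r 5 = int (last_low (y - 1))" "r 10 = 1" "r 11 = 0" "r 15 = 2 * int n + 1"
    and m: "scan_mem y m"
    using c unfolding scanned_def scan_regs_def c' by auto
  have my: "m (y - 1) = int (t (y - 1))" using m y unfolding scan_mem_def by auto
  have cell: "nat (int y - 1) = y - 1" using y by simp
  have ry: "reach y = min (int (prev y) - 1) (2 * int (prev y) - int y + int lam - 1)"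
    by (simp add: reach_def)
  \<comment> \<open>The run is cut at instruction 17, after the branches for the two arguments of
    the minimum in \<open>reach y\<close> have met again.\<close>
  define Q where "Q c \<longleftrightarrow> pc c = 17 \<and> scan_regs y (reg c) \<and> reg c 5 = int (last_low (y - 1)) \<and>
    reg c 6 = 2 * int (prev y) - int y \<and> reg c 7 = reach y \<and> reg c 8 = int (prev y) \<and>
    reg c 13 = int (t (y - 1)) \<and> reg c 16 = int y \<and> mem c = m(y - 1 := 0)" for c :: config
  have "reaches prog 13 Q c"
  proof (cases "2 * int (prev y) - int y + int lam - 1 < int (prev y) - 1")
    case True
    have "reaches prog 12 Q c"
      unfolding c' using y True
      by - ((rule reaches_exec, simp add: length_prog, simp, simp add: prog_nth exec_config r not_less)+,
          rule reaches_0, simp add: Q_def scan_regs_def r ry my[unfolded One_nat_def] cell)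
    then show ?thesis by (rule reaches_mono) simp
  next
    case False
    show ?thesis
      unfolding c' using y False
      by - ((rule reaches_exec, simp add: length_prog, simp, simp add: prog_nth exec_config r not_less)+,
          rule reaches_0, simp add: Q_def scan_regs_def r ry my[unfolded One_nat_def] cell)
  qed
  moreover have "reaches prog 8 (classified y) c1" if "Q c1" for c1
  proof -
    obtain r' m' where c1: "c1 = \<lparr>pc = 17, reg = r', mem = m'\<rparr>"
      using \<open>Q c1\<close> unfolding Q_def by (cases c1) auto
    have r': "r' 0 = int n" "r' 1 = int lam" "r' (Suc 0) = int lam" "r' 2 = int y" "r' 3 = int (prev y)"
      "r' 4 = int (from_pos y)" "r' 5 = int (last_low (y - 1))" "r' 6 = 2 * int (prev y) - int y"
      "r' 7 = reach y" "r' 8 = int (prev y)" "r' 10 = 1" "r' 11 = 0" "r' 13 = int (t (y - 1))"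
      "r' 15 = 2 * int n + 1" "r' 16 = int y" and m': "m' = m(y - 1 := 0)"
      using \<open>Q c1\<close> unfolding Q_def scan_regs_def c1 by auto
    have M: "\<exists>m. scan_mem y m \<and> m' = m(y - Suc 0 := 0)" using m m' by auto
    \<comment> \<open>A nonempty interval of candidates puts \<open>reach y\<close> between 1 and
      \<open>y - 1\<close>, where \<open>last_low\<close> is already stored.\<close>
    have load: "m' (nat (int n + reach y)) = int (last_low (nat (reach y)))" if "int (from_pos y) \<le> reach y"
    proof -
      have "prev y < y" using y(1) by (intro prev_less) simp
      have "0 < from_pos y"
        using that reach_less[of y] by (auto simp: from_pos_def split: if_splits)
      define i where "i = nat (reach y)"
      have i: "reach y = int i" "1 \<le> i" "i < y"
        using that reach_less[of y] \<open>prev y < y\<close> \<open>0 < from_pos y\<close> unfolding i_def by linarith+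
      then have "nat (int n + reach y) = n + i" by simp
      then show ?thesis using m i y unfolding scan_mem_def m' by auto
    qed
    show ?thesis
    proof (cases "int (from_pos y) \<le> reach y")
      case far: False
      then have ns: "\<not> saves y" using saves_iff[of y] by simp
      show ?thesis
      proof (cases "prev y = 0")
        case True
        have "reaches prog 2 (classified y) c1"
          unfolding c1 using True far
          by - ((rule reaches_exec, simp add: length_prog, simp, simp add: prog_nth exec_config r' not_less)+,
              rule reaches_0, simp add: classified_def scan_regs_def r' M ns pred_def)
        then show ?thesis by (rule reaches_mono) simp
      next
        case False
        have "reaches prog 3 (classified y) c1"
          unfolding c1 using False far
          by - ((rule reaches_exec, simp add: length_prog, simp, simp add: prog_nth exec_config r' not_less)+,
              rule reaches_0, simp add: classified_def scan_regs_def r' M ns pred_def)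
        then show ?thesis by (rule reaches_mono) simp
      qed
    next
      case near: True
      note l = load[OF near]
      show ?thesis
      proof (cases "saves y")
        case True
        then have w: "2 * int (prev y) - int y - int lam < int (last_low (nat (reach y)))"
          using saves_iff[of y] by simp
        show ?thesis
          unfolding c1 using near w
          by - ((rule reaches_exec, simp add: length_prog, simp, simp add: prog_nth exec_config r' l not_less)+,
              rule reaches_0, simp add: classified_def scan_regs_def r' M True pred_def)
      next
        case ns: False
        then have w: "\<not> 2 * int (prev y) - int y - int lam < int (last_low (nat (reach y)))"
          using saves_iff[of y] near by simp
        have False: "prev y \<noteq> 0" using near reach_less[of y] by linarith
        show ?thesis
          unfolding c1 using near w False
          by - ((rule reaches_exec, simp add: length_prog, simp, simp add: prog_nth exec_config r' l not_less)+,
              rule reaches_0, simp add: classified_def scan_regs_def r' M ns pred_def)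
      qed
    qed
  qed
  ultimately have "reaches prog (13 + 8) (classified y) c" by (rule reaches_trans)
  then show ?thesis by (rule reaches_mono) simp
qed

text \<open>The three written cells lie in disjoint regions of the memory, so no write damages
  another table.\<close>

lemma scan_mem_Suc:
  assumes "1 \<le> y" "y \<le> n" "scan_mem y m"
  shows "scan_mem (Suc y) (m(y - 1 := 0, n + y := int (last_low y), Suc (2 * n + y) := int (pred y)))"
  using assms unfolding scan_mem_def by (auto simp: less_Suc_eq)

lemma reaches_scan_Suc:
  assumes y: "1 \<le> y" "y \<le> n" and c: "classified y c"
  shows "reaches prog 10 (scanned (Suc y)) c"
proof -
  obtain r m' where c': "c = \<lparr>pc = 28, reg = r, mem = m'\<rparr>"
    using c unfolding classified_def by (cases c) auto
  define a where "a = (if saves y then y else last_low (y - 1))"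
  define b where "b = (if prev y = 0 \<or> saves y then y else prev y)"
  have r: "r 0 = int n" "r 1 = int lam" "r (Suc 0) = int lam" "r 2 = int y" "r 3 = int (prev y)"
    "r 4 = int (from_pos y)" "r 5 = int a" "r 8 = int (pred y)" "r 10 = 1" "r 11 = 0"
    "r 13 = int (t (y - 1))" "r 15 = 2 * int n + 1" "r 16 = int b"
    using c unfolding classified_def scan_regs_def c' a_def b_def by auto
  obtain m where m: "scan_mem y m" "m' = m(y - 1 := 0)"
    using c unfolding classified_def c' by auto
  have ll: "last_low y = (if T y then y else a)"
    using y(1) by (cases y) (simp_all add: low_def a_def)
  have pr: "prev (Suc y) = (if T y then y else prev y)" by simp
  have fr: "from_pos (Suc y) = (if T y then b else from_pos y)"
    by (simp add: from_pos_def b_def)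
  have ty: "T y \<longleftrightarrow> 1 < t (y - 1)" using y by (simp add: T_def)
  have addr: "nat (int n + int y) = n + y" "nat (2 * int n + 1 + int y) = Suc (2 * n + y)" by simp_all
  note mem = scan_mem_Suc[OF y m(1), folded m(2)]
  show ?thesis
  proof (cases "T y")
    case True
    then have "1 < t (y - 1)" using ty by simp
    show ?thesis
      unfolding c' using \<open>1 < t (y - 1)\<close>
      by - ((rule reaches_exec, simp add: length_prog, simp, simp add: prog_nth exec_config r addr not_less)+,
          rule reaches_0, insert mem True, simp add: scanned_def scan_regs_def r ll fr)
  next
    case False
    then have "\<not> 1 < t (y - 1)" using ty by simp
    have "reaches prog 8 (scanned (Suc y)) c"
      unfolding c' using \<open>\<not> 1 < t (y - 1)\<close>
      by - ((rule reaches_exec, simp add: length_prog, simp, simp add: prog_nth exec_config r addr not_less)+,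
          rule reaches_0, insert mem False, simp add: scanned_def scan_regs_def r ll fr)
    then show ?thesis by (rule reaches_mono) simp
  qed
qed

lemma reaches_scanned:
  assumes "k \<le> n" "scanned 1 c"
  shows "reaches prog (40 * k) (scanned (Suc k)) c"
  using assms(1)
proof (induction k)
  case 0
  then show ?case using assms(2) by (intro reaches_0) simp
next
  case (Suc k)
  have "reaches prog (30 + 10) (scanned (Suc (Suc k))) c'" if "scanned (Suc k) c'" for c'
    by (rule reaches_trans[OF reaches_classified[OF _ _ that] reaches_scan_Suc]) (use Suc.prems in auto)
  then have "reaches prog (40 * k + (30 + 10)) (scanned (Suc (Suc k))) c"
    using Suc by (intro reaches_trans[OF Suc.IH]) simp_all
  then show ?case by (rule reaches_mono) simp
qed

text \<open>Registers 3, 4 and 5 are initially 0, which is the value of \<open>prev 1\<close>,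
  \<open>from_pos 1\<close> and \<open>last_low 0\<close>.\<close>

lemma reaches_init: "reaches prog 4 (scanned 1) (path_input n lam t)"
  unfolding path_input_def
  by ((rule reaches_exec, simp add: length_prog, simp, simp add: prog_nth exec_config numeral_2_eq_2[symmetric])+,
      rule reaches_0, simp add: scanned_def scan_regs_def scan_mem_def from_pos_def T0)

section \<open>Marking the chain\<close>

definition marking :: "nat set \<Rightarrow> nat \<Rightarrow> config \<Rightarrow> bool" where
  "marking D y c \<longleftrightarrow> pc c = 41 \<and> reg c 3 = int y \<and> reg c 10 = 1 \<and> reg c 11 = 0 \<and>
     reg c 15 = 2 * int n + 1 \<and> (\<forall>x<n. mem c x = (if Suc x \<in> D then 1 else 0)) \<and>
     (\<forall>x\<in>{1..n}. mem c (Suc (2 * n + x)) = int (pred x))"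

definition marked :: "nat set \<Rightarrow> config \<Rightarrow> bool" where
  "marked D c \<longleftrightarrow> halted prog c \<and> (\<forall>x<n. mem c x = (if Suc x \<in> D then 1 else 0))"

lemma reaches_marking:
  assumes "scanned (Suc n) c"
  shows "reaches prog 3 (marking {} (goal_pos n)) c"
proof -
  obtain r m where c': "c = \<lparr>pc = 4, reg = r, mem = m\<rparr>"
    using assms unfolding scanned_def by (cases c) auto
  define p where "p = prev (Suc n)"
  have r: "r 0 = int n" "r 2 = int n + 1" "r 3 = int p" "r 10 = 1" "r 11 = 0" "r 15 = 2 * int n + 1"
    and m: "scan_mem (Suc n) m"
    using assms unfolding scanned_def scan_regs_def c' p_def by auto
  have mem: "\<forall>x<n. m x = 0" "\<forall>x\<in>{1..n}. m (Suc (2 * n + x)) = int (pred x)"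
    using m unfolding scan_mem_def by auto
  have g: "goal_pos n = (if p = 0 then 1 else p)" by (simp add: goal_pos_def p_def)
  show ?thesis
  proof (cases "p = 0")
    case True
    show ?thesis
      unfolding c' using True
      by - ((rule reaches_exec, simp add: length_prog, simp, simp add: prog_nth exec_config r not_less)+,
          rule reaches_0, simp add: marking_def r g mem)
  next
    case False
    have "reaches prog 2 (marking {} (goal_pos n)) c"
      unfolding c' using False
      by - ((rule reaches_exec, simp add: length_prog, simp, simp add: prog_nth exec_config r not_less)+,
          rule reaches_0, simp add: marking_def r g mem)
    then show ?thesis by (rule reaches_mono) simp
  qed
qed

text \<open>\<open>D\<close> accumulates the positions already marked. Each turn takes five
  instructions and strictly decreases the position, hence the bound \<open>5 * y\<close>; at
  \<open>pred y = 0\<close> control leaves the program.\<close>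

lemma reaches_marked:
  assumes "1 \<le> y" "y \<le> n" "marking D y c"
  shows "reaches prog (5 * y) (marked (D \<union> chain y)) c"
  using assms
proof (induction y arbitrary: D c rule: less_induct)
  case (less y)
  obtain r m where c: "c = \<lparr>pc = 41, reg = r, mem = m\<rparr>"
    using less.prems(3) unfolding marking_def by (cases c) auto
  have r: "r 3 = int y" "r 10 = 1" "r 11 = 0" "r 15 = 2 * int n + 1"
    and m: "\<forall>x<n. m x = (if Suc x \<in> D then 1 else 0)"
      "\<forall>x\<in>{1..n}. m (Suc (2 * n + x)) = int (pred x)"
    using less.prems(3) unfolding marking_def c by auto
  have addr: "nat (int y - 1) = y - 1" "nat (2 * int n + 1 + int y) = Suc (2 * n + y)"
    using less.prems(1) by simp_all
  define m' where "m' = m(y - 1 := 1)"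
  have m': "\<forall>x<n. m' x = (if Suc x \<in> insert y D then 1 else 0)"
    "\<forall>x\<in>{1..n}. m' (Suc (2 * n + x)) = int (pred x)"
    using m less.prems(1,2) unfolding m'_def by auto
  have load: "m' (Suc (2 * n + y)) = int (pred y)" using m'(2) less.prems(1,2) by simp
  have fold: "m(y - Suc 0 := 1) = m'" by (simp add: m'_def)
  have ch: "D \<union> chain y = insert y D \<union> chain (pred y)" using chain_pos[of y] less.prems(1) by simp
  show ?case
  proof (cases "pred y = 0")
    case True
    have "reaches prog 5 (marked (D \<union> chain y)) c"
      unfolding c using True
      by - ((rule reaches_exec, simp add: length_prog, simp, simp add: prog_nth exec_config r addr fold load not_less)+,
          rule reaches_0, insert m', simp add: marked_def halted_def length_prog ch)
    then show ?thesis by (rule reaches_mono) (use less.prems(1) in simp)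
  next
    case False
    have first: "reaches prog 5 (marking (insert y D) (pred y)) c"
      unfolding c using False
      by - ((rule reaches_exec, simp add: length_prog, simp, simp add: prog_nth exec_config r addr fold load not_less)+,
          rule reaches_0, insert m', simp add: marking_def r)
    have "pred y < y" using less.prems(1) by (simp add: pred_less)
    have "reaches prog (5 * pred y) (marked (insert y D \<union> chain (pred y))) c'"
      if "marking (insert y D) (pred y) c'" for c'
      using less.IH[OF \<open>pred y < y\<close> _ _ that] False less.prems(2) \<open>pred y < y\<close> by simp
    with first have "reaches prog (5 + 5 * pred y) (marked (insert y D \<union> chain (pred y))) c"
      by (rule reaches_trans)
    then show ?thesis unfolding ch by (rule reaches_mono) (use \<open>pred y < y\<close> in simp)
  qed
qed

lemma run_prog: "marked (chain (goal_pos n)) (run prog (45 * n + 7) (path_input n lam t))"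
proof -
  have g: "1 \<le> goal_pos n" "goal_pos n \<le> n" using goal_pos_range[OF n] by auto
  let ?Q = "marked (chain (goal_pos n))"
  have 1: "reaches prog (5 * goal_pos n) ?Q c" if "marking {} (goal_pos n) c" for c
    using reaches_marked[OF g that] by simp
  have 2: "reaches prog (3 + 5 * goal_pos n) ?Q c" if "scanned (Suc n) c" for c
    using reaches_marking[OF that] 1 by (rule reaches_trans)
  have 3: "reaches prog (40 * n + (3 + 5 * goal_pos n)) ?Q c" if "scanned 1 c" for c
    using reaches_scanned[OF order_refl that] 2 by (rule reaches_trans)
  \<comment> \<open>Initialization, the scan at 40 steps per position, the passage to the second
    loop, and the marking; \<open>goal_pos n\<close> is at most \<open>n\<close>.\<close>
  have "reaches prog (4 + (40 * n + (3 + 5 * goal_pos n))) ?Q (path_input n lam t)"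
    using reaches_init 3 by (rule reaches_trans)
  then have "reaches prog (45 * n + 7) ?Q (path_input n lam t)"
    by (rule reaches_mono) (use g in simp)
  then show ?thesis by (rule run_reaches_halted) (simp add: marked_def)
qed

end

section \<open>From positions back to nodes\<close>

text \<open>Order and the quantity \<open>l + r - 2 v\<close> are invariant under a common shift of
  \<open>l\<close>, \<open>r\<close> and \<open>v\<close>.\<close>

lemma spans_shift:
  "spans (\<lambda>v. 0 < v \<and> T (v - 1)) lam (Suc ` S) \<longleftrightarrow> spans T lam S"
proof -
  \<comment> \<open>Splits off the value 0, at which the shifted predicate is false.\<close>
  have all: "(\<forall>v. P v) \<longleftrightarrow> P 0 \<and> (\<forall>v. P (Suc v))" for P :: "nat \<Rightarrow> bool"
    by (metis not0_implies_Suc)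
  have hop: "hop (\<lambda>v. 0 < v \<and> T (v - Suc 0)) lam (Suc l) (Suc r) \<longleftrightarrow> hop T lam l r" for l r
    unfolding hop_def by (subst (1 2) all) (simp add: algebra_simps)
  show ?thesis
    unfolding spans_def by (subst (1 2) all) (auto simp: hop image_iff)
qed

theorem theorem2:
  shows "\<exists>(P :: program) (T :: nat \<Rightarrow> nat).
           (\<lambda>n. real (T n)) \<in> O(\<lambda>n. real n) \<and>
           (\<forall>(lam :: nat) (n :: nat) (t :: nat \<Rightarrow> nat).
              1 \<le> lam \<longrightarrow> 1 \<le> n \<longrightarrow> threshold_function (path_graph n) t \<longrightarrow>
              halted P (run P (T n) (path_input n lam t)) \<and>
              (\<exists>S. is_output_set n (run P (T n) (path_input n lam t)) S \<and>
                   min_twc_target_set (path_graph n) t lam S))"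
proof (intro exI[of _ prog] exI[of _ "\<lambda>n. 45 * n + 7"] conjI allI impI)
  show "(\<lambda>n. real (45 * n + 7)) \<in> O(\<lambda>n. real n)"
    \<comment> \<open>For \<open>n\<close> at least 1, \<open>45 * n + 7\<close> is at most
      \<open>52 * n\<close>.\<close>
    by (rule bigoI[of _ 52]) (auto intro!: eventually_sequentiallyI[of 1])
next
  fix lam n :: nat and t :: "nat \<Rightarrow> nat"
  assume lam: "1 \<le> lam" and n: "1 \<le> n" and thr: "threshold_function (path_graph n) t"
  interpret path_instance n lam t by unfold_locales fact+
  interpret path_program n lam t by unfold_locales fact
  define D where "D = chain (goal_pos n)"
  define S where "S = {x. Suc x \<in> D}"
  have D: "D \<subseteq> {1..n}" using chain_range[of "goal_pos n"] goal_pos_range[OF n] unfolding D_def by auto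
  \<comment> \<open>Nothing is lost in passing from \<open>D\<close> to \<open>S\<close> because 0
    is not in \<open>D\<close>.\<close>
  have DS: "D = Suc ` S"
  proof -
    have "x \<in> Suc ` S" if "x \<in> D" for x using that D unfolding S_def by (cases x) auto
    then show ?thesis unfolding S_def by auto
  qed
  have T: "T = (\<lambda>v. 0 < v \<and> two (v - 1))" unfolding T_def two_def by (auto simp: fun_eq_iff)
  have fin: "marked D (run prog (45 * n + 7) (path_input n lam t))" unfolding D_def by (rule run_prog)
  then show "halted prog (run prog (45 * n + 7) (path_input n lam t))" by (simp add: marked_def)
  have S: "S \<subseteq> {0..<n}" using D unfolding S_def by auto
  have "spans T lam D" unfolding D_def by (rule spans_chain) (simp add: T_def)
  then have "twc_target_set (path_graph n) t lam S"
    using n S unfolding twc_target_set_iff[of S] DS T spans_shift by (simp add: twc_target_set_iff)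
  moreover have "card S \<le> card S'" if "twc_target_set (path_graph n) t lam S'" for S'
  proof -
    have S': "S' \<subseteq> {0..<n}" "spans two lam S'" using that n by (simp_all add: twc_target_set_iff)
    then have "spans T lam (Suc ` S')" unfolding T spans_shift by simp
    moreover have "Suc ` S' \<subseteq> {1..n}" using S' by auto
    ultimately have "card D \<le> card (Suc ` S')" unfolding D_def by (intro card_chain_le)
    then show ?thesis unfolding DS by (simp add: card_image)
  qed
  ultimately have "min_twc_target_set (path_graph n) t lam S" by (simp add: min_twc_target_set_def)
  moreover have "is_output_set n (run prog (45 * n + 7) (path_input n lam t)) S"
    using fin S unfolding marked_def is_output_set_def S_def by simp
  ultimately show "\<exists>S. is_output_set n (run prog (45 * n + 7) (path_input n lam t)) S \<and>
      min_twc_target_set (path_graph n) t lam S" by blast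
qed

end
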